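(* Let $0<\alpha\leq\infty$. For a continuous function $f\colon[0,\alpha)\to\mathbf{R}$ put $g(t)=f(t)/t$ for $t\in(0,\alpha)$. If $f(0)\leq 0$ and $f$ is convex on $[0,\alpha)$, then $g$ is monotone increasing (non-decreasing) on $(0,\alpha)$. The converse does not hold: there exists a continuous function $f\colon[0,\alpha)\to\mathbf{R}$ such that $g$ is monotone increasing (non-decreasing) on $(0,\alpha)$ but it is not the case that $f(0)\leq 0$ and $f$ is convex on $[0,\alpha)$. *)

theory Defs
  imports "HOL-Analysis.Analysis"
begin

end

theory Submission
  imports Defs
begin

text \<open>For 0 < x \<le> y, the point x is the convex combination of 0 and y with weight x / y on
  y. Convexity and f(0) \<le> 0 give f(x) \<le> (x / y) f(y), and dividing by x gives g(x) \<le>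
  g(y); this is \<open>convex_on_imp_mono_on_quotient\<close>. For the converse, choose the quotient
  first: g(t) = min(t, c) is non-decreasing, and f(t) = t g(t) is continuous with f(0) = 0.
  Convexity is what must fail, since a continuous f with f(0) > 0 would make g blow up at 0. It
  fails at the concave kink t = c, by \<open>not_convex_on_mult_min\<close>.\<close>

lemma convex_on_imp_mono_on_quotient:
  fixes f :: "real \<Rightarrow> real"
  assumes "convex_on S f" "0 \<in> S" "f 0 \<le> 0"
  shows "mono_on {t \<in> S. 0 < t} (\<lambda>t. f t / t)"
proof (rule mono_onI)
  fix x y assume "x \<in> {t \<in> S. 0 < t}" "y \<in> {t \<in> S. 0 < t}" "x \<le> y"
  then have xy: "0 < x" "0 < y" "x / y \<le> 1" "y \<in> S"
    by auto
  have "f x = f ((1 - x / y) *\<^sub>R 0 + (x / y) *\<^sub>R y)"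
    using xy by simp
  also have "\<dots> \<le> (1 - x / y) * f 0 + x / y * f y"
    using xy assms by (intro convex_onD[OF assms(1)]) auto
  also have "\<dots> \<le> x / y * f y"
    using xy assms(3) by (simp add: mult_nonneg_nonpos)
  finally show "f x / x \<le> f y / y"
    using xy by (simp add: field_simps)
qed

text \<open>The slope of this function drops from \<open>2 * c\<close> to \<open>c\<close> at \<open>t = c\<close>.\<close>
lemma not_convex_on_mult_min:
  fixes c :: real
  assumes "0 < c" "c / 2 \<in> S" "3 * c / 2 \<in> S"
  shows "\<not> convex_on S (\<lambda>t. t * min t c)"
proof
  assume "convex_on S (\<lambda>t. t * min t c)"
  \<comment> \<open>Midpoint test around the kink: the value at c is c^2, while the values c^2 / 4
    and 3 c^2 / 2 at the two endpoints average to 7 c^2 / 8.\<close>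
  from convex_onD[OF this, of "1 / 2" "c / 2" "3 * c / 2"] assms
  have "c * c \<le> (7 / 8) * (c * c)"
    by (simp add: min_def)
  moreover have "0 < c * c"
    using assms(1) by simp
  ultimately show False
    by linarith
qed

theorem proposition3p5:
  fixes \<alpha> :: ereal
  assumes "0 < \<alpha>"
  shows "(\<forall>f :: real \<Rightarrow> real.
            continuous_on {t. 0 \<le> t \<and> ereal t < \<alpha>} f \<longrightarrow>
            f 0 \<le> 0 \<and> convex_on {t. 0 \<le> t \<and> ereal t < \<alpha>} f \<longrightarrow>
            mono_on {t. 0 < t \<and> ereal t < \<alpha>} (\<lambda>t. f t / t))
       \<and> (\<exists>f :: real \<Rightarrow> real.
            continuous_on {t. 0 \<le> t \<and> ereal t < \<alpha>} f \<and>
            mono_on {t. 0 < t \<and> ereal t < \<alpha>} (\<lambda>t. f t / t) \<and>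
            \<not> (f 0 \<le> 0 \<and> convex_on {t. 0 \<le> t \<and> ereal t < \<alpha>} f))"
proof (intro conjI allI impI)
  fix f :: "real \<Rightarrow> real"
  assume "f 0 \<le> 0 \<and> convex_on {t. 0 \<le> t \<and> ereal t < \<alpha>} f"
  then have "mono_on {t \<in> {t. 0 \<le> t \<and> ereal t < \<alpha>}. 0 < t} (\<lambda>t. f t / t)"
    using assms by (intro convex_on_imp_mono_on_quotient) (auto simp: zero_ereal_def)
  then show "mono_on {t. 0 < t \<and> ereal t < \<alpha>} (\<lambda>t. f t / t)"
    by (rule mono_on_subset) auto
next
  \<comment> \<open>As \<alpha> may be infinite, a real \<open>a\<close> below it fixes the scale.
    Taking c = a / 2 puts both test points c / 2 and 3 c / 2 below a = 2 c, hence inside the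
    domain.\<close>
  obtain a where a: "0 < a" "ereal a < \<alpha>"
    using ereal_dense2[OF assms] by (auto simp: zero_ereal_def)
  define c where "c = a / 2"
  have "0 < c"
    using a by (simp add: c_def)
  have "ereal t < \<alpha>" if "t \<le> 2 * c" for t
    using a that by (auto simp: c_def intro: le_less_trans[of "ereal t" "ereal a"])
  then have "ereal (c / 2) < \<alpha>" "ereal (3 * c / 2) < \<alpha>"
    using \<open>0 < c\<close> by simp_all
  then have "\<not> convex_on {t. 0 \<le> t \<and> ereal t < \<alpha>} (\<lambda>t. t * min t c)"
    using \<open>0 < c\<close> by (intro not_convex_on_mult_min) auto
  moreover have "continuous_on {t. 0 \<le> t \<and> ereal t < \<alpha>} (\<lambda>t. t * min t c)"
    by (intro continuous_intros)
  moreover have "mono_on {t. 0 < t \<and> ereal t < \<alpha>} (\<lambda>t. t * min t c / t)"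
    by (rule mono_onI) auto
  ultimately show "\<exists>f :: real \<Rightarrow> real.
      continuous_on {t. 0 \<le> t \<and> ereal t < \<alpha>} f \<and>
      mono_on {t. 0 < t \<and> ereal t < \<alpha>} (\<lambda>t. f t / t) \<and>
      \<not> (f 0 \<le> 0 \<and> convex_on {t. 0 \<le> t \<and> ereal t < \<alpha>} f)"
    by blast
qed

end
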